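(* Let $\mathcal{H}$ be a complex Hilbert space and let $A,B\in L(\mathcal{H})$ be such that $R(B)=R(A)\dotplus R(B-A)$ (that is, $A$ is below $B$ in the left minus order). If $R(B)$ is closed, then $R(A)$ and $R(B-A)$ are closed, and $A$ is below $B$ in the minus order, i.e. there exist $P,Q\in L(\mathcal{H})$ with $P^2=P$, $Q^2=Q$, $A=PB$ and $A^*=QB^*$.
   Context: $L(\mathcal{H})$ is the algebra of bounded linear operators on $\mathcal{H}$, $R(T)$ is the range of $T$, and $\dotplus$ denotes a direct (algebraic) sum of linear subspaces (trivial intersection). *)

theory Defs
  imports "HOL-Analysis.Analysis"
begin

text \<open>
  Complex Hilbert spaces as a type class over the library's real normed spaces, so that the
  library's topology, completeness and boundedness of linear maps apply unchanged.
  The inner product is linear in its first argument and conjugate-linear in its second.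
\<close>

class complex_inner = real_normed_vector +
  fixes scaleC :: "complex \<Rightarrow> 'a \<Rightarrow> 'a" (infixr \<open>*\<^sub>C\<close> 75)
    and cinner :: "'a \<Rightarrow> 'a \<Rightarrow> complex"
  assumes scaleC_add_right: "c *\<^sub>C (x + y) = c *\<^sub>C x + c *\<^sub>C y"
    and scaleC_add_left: "(c + d) *\<^sub>C x = c *\<^sub>C x + d *\<^sub>C x"
    and scaleC_scaleC: "c *\<^sub>C d *\<^sub>C x = (c * d) *\<^sub>C x"
    and scaleC_of_real: "complex_of_real r *\<^sub>C x = r *\<^sub>R x"
    and cinner_commute: "cinner x y = cnj (cinner y x)"
    and cinner_add_left: "cinner (x + y) z = cinner x z + cinner y z"
    and cinner_scaleC_left: "cinner (c *\<^sub>C x) y = c * cinner x y"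
    and cinner_ge_zero: "0 \<le> Re (cinner x x)"
    and cinner_eq_zero_iff: "cinner x x = 0 \<longleftrightarrow> x = 0"
    and norm_eq_sqrt_cinner: "norm x = sqrt (Re (cinner x x))"

class chilbert_space = complex_inner + complete_space

instantiation complex :: chilbert_space
begin

definition scaleC_complex :: "complex \<Rightarrow> complex \<Rightarrow> complex"
  where "scaleC_complex c x = c * x"

definition cinner_complex :: "complex \<Rightarrow> complex \<Rightarrow> complex"
  where "cinner_complex x y = x * cnj y"

instance
  by standard
    (auto simp: scaleC_complex_def cinner_complex_def algebra_simps scaleR_conv_of_real
      cmod_def power2_eq_square)

end

definition bounded_clinear :: "('a::complex_inner \<Rightarrow> 'a) \<Rightarrow> bool"
  where "bounded_clinear T \<longleftrightarrow> bounded_linear T \<and> (\<forall>c x. T (c *\<^sub>C x) = c *\<^sub>C T x)"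

text \<open>
  Only meaningful for bounded operators on a Hilbert space, where the described map exists by
  the Riesz representation theorem; it is unique whenever it exists.
\<close>

definition cadjoint :: "('a::complex_inner \<Rightarrow> 'a) \<Rightarrow> 'a \<Rightarrow> 'a"
  where "cadjoint T = (THE S. \<forall>x y. cinner (T x) y = cinner x (S y))"

lemma cadjoint_unique:
  fixes T S :: "'a::complex_inner \<Rightarrow> 'a"
  assumes "\<And>x y. cinner (T x) y = cinner x (S y)"
  shows "cadjoint T = S"
  unfolding cadjoint_def
proof (rule the_equality)
  show "\<forall>x y. cinner (T x) y = cinner x (S y)"
    using assms by blast
next
  fix S' assume S': "\<forall>x y. cinner (T x) y = cinner x (S' y)"
  show "S' = S"
  proof
    fix y
    have "cinner x (S' y) = cinner x (S y)" for x
      using S' assms by metis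
    then have *: "cinner (S' y) x = cinner (S y) x" for x
      by (metis cinner_commute)
    have "cinner (S' y) x = cinner (S' y - S y) x + cinner (S y) x" for x
      using cinner_add_left[of "S' y - S y" "S y" x] by simp
    then have "cinner (S' y - S y) (S' y - S y) = 0"
      using * by (metis add_cancel_left_left)
    then show "S' y = S y"
      by (simp add: cinner_eq_zero_iff)
  qed
qed

definition is_direct_sum :: "'a::real_vector set \<Rightarrow> 'a set \<Rightarrow> 'a set \<Rightarrow> bool"
  where "is_direct_sum S M N \<longleftrightarrow> S = {x + y |x y. x \<in> M \<and> y \<in> N} \<and> M \<inter> N = {0}"

end

theory Submission
  imports Defs
begin

text \<open>
  Since \<open>R(A)\<close> and \<open>R(B - A)\<close> intersect trivially, \<open>B z = a + c\<close> with \<open>a \<in> R(A)\<close> and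
  \<open>c \<in> R(B - A)\<close> forces \<open>A z = a\<close>; in particular \<open>A z\<close> depends only on \<open>B z\<close>. As \<open>R(B)\<close> is
  closed, the open mapping theorem makes the Moore--Penrose inverse \<open>G\<close> of \<open>B\<close> bounded, and
  \<open>B G A = A\<close>, \<open>A G A = A\<close> and \<open>A G B = A\<close>. Hence \<open>P = A G\<close> and \<open>E = G A\<close> are idempotent with
  \<open>A = P B = B E\<close>, so \<open>Q = E\<^sup>*\<close> works, and \<open>R(A) = {y. P y = y}\<close> and
  \<open>R(B - A) = R(B) \<inter> {y. P y = 0}\<close> are closed.
\<close>

subsection \<open>Bounded preimages under an operator with closed range\<close>

text \<open>This is the Baire half of the open mapping theorem. The closed range is completely
  metrizable and covered by the closures of the images of balls of integer radius, so one closure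
  has interior relative to the range; translation to the origin and rescaling then give norm control
  on all of the range.\<close>

lemma closed_range_approx_preimage:
  fixes f :: "'a::banach \<Rightarrow> 'b::banach"
  assumes "bounded_linear f" and cl: "closed (range f)"
  obtains K where "K > 0"
    "\<And>v e. v \<in> range f \<Longrightarrow> e > 0 \<Longrightarrow> \<exists>a. norm a \<le> K * norm v \<and> norm (v - f a) < e"
proof -
  interpret f: bounded_linear f by fact
  let ?S = "range f" and ?F = "\<lambda>n::nat. closure (f ` cball 0 (real n))"
  let ?X = "top_of_set ?S"
  have FS: "?F n \<subseteq> ?S" for n
    using cl by (meson closure_minimal image_mono subset_UNIV)
  have "completely_metrizable_space ?X"
    using cl by (simp add: completely_metrizable_space_closedin completely_metrizable_space_euclidean)
  moreover have "f x \<in> \<Union> (range ?F)" for x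
  proof -
    obtain n where "norm x \<le> real n"
      using real_arch_simple by blast
    then have "f x \<in> ?F n"
      by (intro subsetD[OF closure_subset]) auto
    then show ?thesis by blast
  qed
  then have "\<Union> (range ?F) = ?S"
    using FS by blast
  then have "?X interior_of \<Union> (range ?F) \<noteq> {}"
    using interior_of_topspace[of ?X] by auto
  moreover have "closedin ?X (?F n)" for n
    using FS by (simp add: closed_subset)
  ultimately have "\<exists>n. ?X interior_of ?F n \<noteq> {}"
    using Baire_category_alt[of ?X "range ?F"] by fastforce
  then obtain n where "?X interior_of ?F n \<noteq> {}" ..
  then obtain y U where U: "open U" "y \<in> ?S" "y \<in> U" "U \<inter> ?S \<subseteq> ?F n"
    unfolding interior_of_def by (auto simp: openin_open)
  then obtain r where r: "r > 0" "cball y r \<subseteq> U"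
    using open_contains_cball by blast
  \<comment> \<open>The ball found lies around \<open>y\<close>, not around 0. Both
    \<open>y + w\<close> and \<open>y\<close> are approximated by images of vectors of norm at most
    \<open>n\<close>; the difference of these vectors almost hits \<open>w\<close>, at the price of
    the factor 2.\<close>
  have near: "\<exists>a. norm a \<le> 2 * real n \<and> norm (w - f a) < e"
    if w: "w \<in> ?S" "norm w \<le> r" and e: "e > 0" for w e
  proof -
    have "y + w \<in> ?S"
      using U(2) w(1) by (auto simp flip: f.add)
    moreover have "y + w \<in> cball y r"
      using w by (simp add: dist_norm)
    ultimately have "y + w \<in> ?F n" "y \<in> ?F n"
      using U r by blast+
    then obtain u v where "u \<in> f ` cball 0 (real n)" "dist u (y + w) < e / 2"
      "v \<in> f ` cball 0 (real n)" "dist v y < e / 2"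
      using e unfolding closure_approachable by (meson half_gt_zero)
    then obtain a b where a: "norm a \<le> real n" "dist (f a) (y + w) < e / 2"
      and b: "norm b \<le> real n" "dist (f b) y < e / 2"
      by auto
    have "norm (a - b) \<le> 2 * real n"
      using a b norm_triangle_ineq4[of a b] by linarith
    moreover have "norm ((y + w - f a) - (y - f b)) < e"
      using a b norm_triangle_ineq4[of "y + w - f a" "y - f b"]
      unfolding dist_norm by (smt (verit) norm_minus_commute field_sum_of_halves)
    then have "norm (w - f (a - b)) < e"
      by (simp add: f.diff algebra_simps)
    ultimately show ?thesis by blast
  qed
  \<comment> \<open>The quotient is the cost of rescaling from norm \<open>r\<close>; the summand 1
    keeps \<open>K\<close> positive even if \<open>n = 0\<close>.\<close>
  define K where "K = 2 * real n / r + 1"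
  show thesis
  proof
    show "K > 0" using r by (simp add: K_def add_nonneg_pos)
    fix v and e :: real assume v: "v \<in> ?S" and e: "e > 0"
    show "\<exists>a. norm a \<le> K * norm v \<and> norm (v - f a) < e"
    proof (cases "v = 0")
      case True
      then show ?thesis using e by (intro exI[of _ 0]) (simp add: f.zero)
    next
      case False
      \<comment> \<open>Scaling by \<open>c\<close> brings \<open>v\<close> to norm
        \<open>r\<close>; the tolerance \<open>c * e\<close> becomes \<open>e\<close> after dividing
        by \<open>c\<close> again.\<close>
      define c where "c = r / norm v"
      have c: "c > 0" using False r by (simp add: c_def)
      have "c *\<^sub>R v \<in> ?S" using v by (auto simp flip: f.scaleR)
      moreover have "norm (c *\<^sub>R v) \<le> r" using False r by (simp add: c_def)
      ultimately obtain a where a: "norm a \<le> 2 * real n" "norm (c *\<^sub>R v - f a) < c * e"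
        using near[of "c *\<^sub>R v" "c * e"] c e by auto
      have "norm (a /\<^sub>R c) \<le> 2 * real n / r * norm v"
        using a c r False by (simp add: c_def field_simps mult_left_mono)
      then have "norm (a /\<^sub>R c) \<le> K * norm v"
        by (simp add: K_def distrib_right add_increasing2)
      moreover have "c *\<^sub>R v - f a = c *\<^sub>R (v - f (a /\<^sub>R c))"
        using c by (simp add: f.scaleR algebra_simps)
      then have "norm (v - f (a /\<^sub>R c)) < e"
        using a(2) c by simp
      ultimately show ?thesis by blast
    qed
  qed
qed

text \<open>Successive approximation: each correction halves the residual, and completeness of the
  domain lets the corrections be summed. The geometric series doubles the constant.\<close>

lemma closed_range_bounded_preimage:
  fixes f :: "'a::banach \<Rightarrow> 'b::banach"
  assumes "bounded_linear f" and "closed (range f)"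
  obtains K where "\<And>v. v \<in> range f \<Longrightarrow> \<exists>a. f a = v \<and> norm a \<le> K * norm v"
proof -
  interpret f: bounded_linear f by fact
  obtain K where K: "K > 0"
    "\<And>v e. v \<in> range f \<Longrightarrow> e > 0 \<Longrightarrow> \<exists>a. norm a \<le> K * norm v \<and> norm (v - f a) < e"
    using closed_range_approx_preimage[OF assms] by blast
  have "\<exists>a. norm a \<le> K * norm v \<and> norm (v - f a) \<le> norm v / 2" if "v \<in> range f" for v
  proof (cases "v = 0")
    case True
    then show ?thesis by (intro exI[of _ 0]) (simp add: f.zero)
  next
    case False
    then show ?thesis using K(2)[OF that, of "norm v / 2"] by force
  qed
  then obtain h where h: "\<And>v. v \<in> range f \<Longrightarrow> norm (h v) \<le> K * norm v"
    "\<And>v. v \<in> range f \<Longrightarrow> norm (v - f (h v)) \<le> norm v / 2"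
    by metis
  have "\<exists>a. f a = v \<and> norm a \<le> 2 * K * norm v" if v: "v \<in> range f" for v
  proof -
    \<comment> \<open>\<open>r n\<close> is the residual after \<open>n\<close> corrections. Since
      \<open>f (h (r n))\<close> is the drop from \<open>r n\<close> to \<open>r (Suc n)\<close>,
      these images telescope to \<open>r 0 = v\<close>.\<close>
    define r where "r n = ((\<lambda>w. w - f (h w)) ^^ n) v" for n
    have r_Suc: "r (Suc n) = r n - f (h (r n))" for n
      by (simp add: r_def)
    have r_range: "r n \<in> range f" for n
    proof (induction n)
      case (Suc n)
      then show ?case by (auto simp: r_Suc simp flip: f.diff)
    qed (simp add: r_def v)
    have r_norm: "norm (r n) \<le> norm v * (1 / 2) ^ n" for n
    proof (induction n)
      case (Suc n)
      then show ?case using h(2)[OF r_range[of n]] by (simp add: r_Suc)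
    qed (simp add: r_def)
    have bound: "norm (h (r n)) \<le> K * norm v * (1 / 2) ^ n" for n
      using h(1)[OF r_range[of n]] r_norm[of n] K(1)
      by (smt (verit, best) mult.assoc mult_left_mono)
    have geo: "(\<lambda>n. K * norm v * (1 / 2) ^ n) sums (2 * K * norm v)"
      using sums_mult[OF geometric_sums[of "1 / 2 :: real"], of "K * norm v"] by (simp add: mult_ac)
    have sum: "summable (\<lambda>n. norm (h (r n)))"
      by (rule summable_comparison_test'[OF sums_summable[OF geo]]) (simp only: real_norm_def abs_norm_cancel bound)
    define a where "a = (\<Sum>n. h (r n))"
    have "(\<lambda>n. h (r n)) sums a"
      unfolding a_def by (intro summable_sums summable_norm_cancel[OF sum])
    then have "(\<lambda>n. f (h (r n))) sums f a"
      by (rule f.sums)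
    moreover have "r \<longlonglongrightarrow> 0"
    proof (rule Lim_null_comparison)
      show "(\<lambda>n. norm v * (1 / 2) ^ n) \<longlonglongrightarrow> 0"
        by (intro tendsto_mult_right_zero LIMSEQ_power_zero) simp
    qed (simp add: r_norm)
    then have "(\<lambda>n. r n - r (Suc n)) sums (r 0 - 0)"
      by (rule telescope_sums')
    then have "(\<lambda>n. f (h (r n))) sums v"
      by (simp add: r_Suc) (simp add: r_def)
    ultimately have "f a = v"
      by (rule sums_unique2)
    moreover have "norm a \<le> (\<Sum>n. norm (h (r n)))"
      unfolding a_def using sum by (rule summable_norm)
    moreover have "(\<Sum>n. norm (h (r n))) \<le> 2 * K * norm v"
      using suminf_le[OF bound sum sums_summable[OF geo]] sums_unique[OF geo] by simp
    ultimately show ?thesis by force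
  qed
  then show thesis using that by blast
qed

subsection \<open>Hilbert space geometry and adjoints\<close>

instance chilbert_space \<subseteq> banach ..

section \<open>Calculus of the inner product and its norm\<close>

lemma cinner_add_right: "cinner x (y + z) = cinner x y + cinner x (z::'a::complex_inner)"
  by (metis cinner_add_left cinner_commute complex_cnj_add)

lemma cinner_scaleC_right: "cinner x (c *\<^sub>C y) = cnj c * cinner x (y::'a::complex_inner)"
  by (metis cinner_commute cinner_scaleC_left complex_cnj_mult)

lemma additive_cinner_left: "Modules.additive (\<lambda>x::'a::complex_inner. cinner x y)"
  by (simp add: Modules.additive.intro cinner_add_left)

lemma additive_cinner_right: "Modules.additive (\<lambda>y::'a::complex_inner. cinner x y)"
  by (simp add: Modules.additive.intro cinner_add_right)

lemmas cinner_diff_left = Modules.additive.diff[OF additive_cinner_left]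
  and cinner_diff_right = Modules.additive.diff[OF additive_cinner_right]
  and cinner_zero_left [simp] = Modules.additive.zero[OF additive_cinner_left]
  and cinner_zero_right [simp] = Modules.additive.zero[OF additive_cinner_right]

lemma cinner_scaleR_left: "cinner (r *\<^sub>R x) y = of_real r * cinner x (y::'a::complex_inner)"
  by (metis cinner_scaleC_left scaleC_of_real)

lemma cinner_self: "cinner x x = of_real ((norm (x::'a::complex_inner))\<^sup>2)"
proof (rule complex_eqI)
  show "Re (cinner x x) = Re (of_real ((norm x)\<^sup>2))"
    by (simp add: norm_eq_sqrt_cinner cinner_ge_zero)
  have "Im (cinner x x) = - Im (cinner x x)"
    by (metis cinner_commute cnj.simps(2))
  then show "Im (cinner x x) = Im (of_real ((norm x)\<^sup>2))"
    by simp
qed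

lemma norm_scaleC: "norm (c *\<^sub>C x) = cmod c * norm (x::'a::complex_inner)"
proof -
  have "complex_of_real ((norm (c *\<^sub>C x))\<^sup>2) = c * cnj c * cinner x x"
    unfolding cinner_self[symmetric] by (simp add: cinner_scaleC_left cinner_scaleC_right)
  also have "\<dots> = of_real ((cmod c * norm x)\<^sup>2)"
    by (simp add: cinner_self power_mult_distrib flip: complex_norm_square)
  finally have "complex_of_real ((norm (c *\<^sub>C x))\<^sup>2) = of_real ((cmod c * norm x)\<^sup>2)" .
  then show ?thesis
    by (metis of_real_eq_iff norm_ge_zero mult_nonneg_nonneg power2_eq_iff_nonneg)
qed

lemma norm_diff_sq:
  "(norm (x - y))\<^sup>2 = (norm x)\<^sup>2 - 2 * Re (cinner x y) + (norm (y::'a::complex_inner))\<^sup>2"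
proof -
  have "Re (cinner y x) = Re (cinner x y)"
    by (metis cinner_commute cnj.simps(1))
  moreover have "(norm z)\<^sup>2 = Re (cinner z z)" for z :: 'a
    by (simp add: cinner_self)
  ultimately show ?thesis
    by (simp add: cinner_diff_left cinner_diff_right)
qed

lemma norm_add_sq:
  "(norm (x + y))\<^sup>2 = (norm x)\<^sup>2 + 2 * Re (cinner x y) + (norm (y::'a::complex_inner))\<^sup>2"
  using norm_diff_sq[of x "- y"] Modules.additive.minus[OF additive_cinner_right[of x], of y] by simp

text \<open>Pythagoras for removing from \<open>x\<close> its component along \<open>z\<close>; for
  \<open>z = 0\<close> the convention of division by zero makes both corrections vanish. It yields
  Cauchy-Schwarz and the orthogonality of the nearest-point residual.\<close>

lemma norm_diff_component_sq:
  fixes x z :: "'a::complex_inner"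
  shows "(norm (x - (cinner x z / of_real ((norm z)\<^sup>2)) *\<^sub>C z))\<^sup>2 =
    (norm x)\<^sup>2 - (cmod (cinner x z))\<^sup>2 / (norm z)\<^sup>2"
proof (cases "z = 0")
  case True
  then show ?thesis by (simp add: norm_diff_sq cinner_scaleC_right norm_scaleC)
next
  case False
  let ?c = "cinner x z / of_real ((norm z)\<^sup>2)"
  have "cinner x (?c *\<^sub>C z) = of_real ((cmod (cinner x z))\<^sup>2 / (norm z)\<^sup>2)"
    by (simp add: cinner_scaleC_right mult.commute flip: complex_norm_square)
  then have "Re (cinner x (?c *\<^sub>C z)) = (cmod (cinner x z))\<^sup>2 / (norm z)\<^sup>2"
    by (metis Re_complex_of_real)
  moreover have "(norm (?c *\<^sub>C z))\<^sup>2 = (cmod (cinner x z))\<^sup>2 / (norm z)\<^sup>2"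
    using False by (simp add: norm_scaleC norm_divide norm_mult power_divide power_mult_distrib
        power2_eq_square field_simps)
  ultimately show ?thesis
    by (simp add: norm_diff_sq)
qed

lemma cinner_Cauchy_Schwarz: "cmod (cinner x y) \<le> norm x * norm (y::'a::complex_inner)"
proof (cases "y = 0")
  case False
  have "0 \<le> (norm x)\<^sup>2 - (cmod (cinner x y))\<^sup>2 / (norm y)\<^sup>2"
    using norm_diff_component_sq[of x y] zero_le_power2 by metis
  then have "(cmod (cinner x y))\<^sup>2 \<le> (norm x * norm y)\<^sup>2"
    using False by (simp add: field_simps)
  then show ?thesis
    by (rule power2_le_imp_le) simp
qed simp

section \<open>Projection onto closed complex subspaces and the Riesz theorem\<close>

definition csubspace :: "'a::complex_inner set \<Rightarrow> bool"
  where "csubspace M \<longleftrightarrow>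
    0 \<in> M \<and> (\<forall>x\<in>M. \<forall>y\<in>M. x + y \<in> M) \<and> (\<forall>c. \<forall>x\<in>M. c *\<^sub>C x \<in> M)"

text \<open>A minimizing sequence is Cauchy by the parallelogram law, because midpoints of its
  members stay in \<open>M\<close> and so cannot be closer to \<open>x\<close> than the
  infimum.\<close>

lemma nearest_point_exists:
  fixes M :: "'a::chilbert_space set"
  assumes sub: "csubspace M" and cl: "closed M"
  obtains y where "y \<in> M" "\<And>z. z \<in> M \<Longrightarrow> norm (x - y) \<le> norm (x - z)"
proof -
  have M0: "M \<noteq> {}" using sub by (auto simp: csubspace_def)
  let ?d = "infdist x M"
  have "\<exists>y\<in>M. dist x y < ?d + 1 / real (Suc n)" for n
    using cInf_lessD[of "dist x ` M" "?d + 1 / real (Suc n)"] M0 by (simp add: infdist_notempty)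
  then obtain y where y: "\<And>n. y n \<in> M" "\<And>n. dist x (y n) < ?d + 1 / real (Suc n)"
    by metis
  have lim: "(\<lambda>n. dist x (y n)) \<longlonglongrightarrow> ?d"
  proof (rule tendsto_sandwich[where f = "\<lambda>n. ?d" and h = "\<lambda>n. ?d + 1 / real (Suc n)"])
    show "(\<lambda>n. ?d + 1 / real (Suc n)) \<longlonglongrightarrow> ?d"
      using tendsto_add[OF tendsto_const LIMSEQ_Suc[OF lim_1_over_n]] by fastforce
    show "(\<lambda>n. ?d) \<longlonglongrightarrow> ?d" by simp
    show "\<forall>\<^sub>F n in sequentially. ?d \<le> dist x (y n)"
      by (intro always_eventually allI infdist_le y)
    show "\<forall>\<^sub>F n in sequentially. dist x (y n) \<le> ?d + 1 / real (Suc n)"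
      by (intro always_eventually allI less_imp_le y)
  qed
  have "Cauchy y"
  proof (rule metric_CauchyI)
    fix e :: real assume e: "e > 0"
    have "(\<lambda>n. (dist x (y n))\<^sup>2) \<longlonglongrightarrow> ?d\<^sup>2"
      using lim by (intro tendsto_intros)
    \<comment> \<open>The parallelogram law counts this margin four times, so the squared distance
      of two members comes out below exactly \<open>e\<^sup>2\<close>.\<close>
    then have "\<forall>\<^sub>F n in sequentially. (dist x (y n))\<^sup>2 < ?d\<^sup>2 + e\<^sup>2 / 4"
      using e by (intro order_tendstoD) auto
    then obtain N where N: "\<And>n. n \<ge> N \<Longrightarrow> (dist x (y n))\<^sup>2 < ?d\<^sup>2 + e\<^sup>2 / 4"
      by (auto simp: eventually_sequentially)
    have "dist (y m) (y n) < e" if "m \<ge> N" "n \<ge> N" for m n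
    proof -
      let ?u = "x - y m" and ?v = "x - y n"
      have "complex_of_real (1 / 2) *\<^sub>C (y m + y n) \<in> M"
        using sub y(1) unfolding csubspace_def by blast
      then have "?d \<le> norm (x - (1 / 2) *\<^sub>R (y m + y n))"
        by (metis dist_norm infdist_le scaleC_of_real)
      moreover have uv: "?u + ?v = 2 *\<^sub>R (x - (1 / 2) *\<^sub>R (y m + y n))"
        by (simp add: algebra_simps scaleR_2)
      ultimately have "2 * ?d \<le> norm (?u + ?v)"
        by simp
      then have "(2 * ?d)\<^sup>2 \<le> (norm (?u + ?v))\<^sup>2"
        using infdist_nonneg by (intro power_mono) auto
      moreover have "(norm (?v - ?u))\<^sup>2 + (norm (?u + ?v))\<^sup>2 = 2 * (norm ?u)\<^sup>2 + 2 * (norm ?v)\<^sup>2"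
        using norm_diff_sq[of ?u ?v] norm_add_sq[of ?u ?v] by (simp add: norm_minus_commute)
      ultimately have "(dist (y m) (y n))\<^sup>2 < e\<^sup>2"
        using N[OF that(1)] N[OF that(2)] by (simp add: dist_norm power_mult_distrib)
      then show ?thesis
        using e by (simp add: power_less_imp_less_base)
    qed
    then show "\<exists>N. \<forall>m\<ge>N. \<forall>n\<ge>N. dist (y m) (y n) < e" by blast
  qed
  then obtain l where l: "y \<longlonglongrightarrow> l"
    using Cauchy_convergent convergent_def by blast
  have "dist x l = ?d"
    using LIMSEQ_unique[OF tendsto_dist[OF tendsto_const l] lim] .
  moreover have "l \<in> M"
    using closed_sequentially[OF cl] y(1) l by blast
  ultimately show thesis
    using that infdist_le by (metis dist_norm)
qed

text \<open>The nearest point works: if \<open>x - y\<close> had a nonzero component along some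
  \<open>z\<close> in \<open>M\<close>, moving \<open>y\<close> by that component would bring it
  closer to \<open>x\<close>.\<close>

lemma orthogonal_projection_exists:
  fixes M :: "'a::chilbert_space set"
  assumes sub: "csubspace M" and cl: "closed M"
  obtains y where "y \<in> M" "\<And>z. z \<in> M \<Longrightarrow> cinner (x - y) z = 0"
proof -
  obtain y where y: "y \<in> M" "\<And>z. z \<in> M \<Longrightarrow> norm (x - y) \<le> norm (x - z)"
    using nearest_point_exists[OF assms] by blast
  show thesis
  proof (rule that)
    fix z assume z: "z \<in> M"
    let ?c = "cinner (x - y) z / of_real ((norm z)\<^sup>2)"
    \<comment> \<open>The coefficient is a complex number, hence the closure of
      \<open>csubspace\<close> under complex scalars.\<close>
    have "y + ?c *\<^sub>C z \<in> M"
      using sub y z by (auto simp: csubspace_def)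
    then have "norm (x - y) \<le> norm (x - y - ?c *\<^sub>C z)"
      using y(2) by (metis diff_diff_add)
    then have "(norm (x - y))\<^sup>2 \<le> (norm (x - y - ?c *\<^sub>C z))\<^sup>2"
      by (intro power_mono) auto
    then have "(cmod (cinner (x - y) z))\<^sup>2 / (norm z)\<^sup>2 \<le> 0"
      unfolding norm_diff_component_sq by simp
    then show "cinner (x - y) z = 0"
      by (cases "z = 0") (auto simp: divide_le_0_iff)
  qed (fact y(1))
qed

text \<open>A vector \<open>?w\<close> outside the kernel and orthogonal to it represents
  \<open>f\<close> up to a scalar: subtracting the right multiple of \<open>?w\<close> from
  \<open>x\<close> lands in the kernel, so \<open>cinner x ?w\<close> is proportional to
  \<open>f x\<close>.\<close>

lemma Riesz_representation:
  fixes f :: "'a::chilbert_space \<Rightarrow> complex"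
  assumes "bounded_linear f" and fC: "\<And>c x. f (c *\<^sub>C x) = c * f x"
  obtains y where "\<And>x. f x = cinner x y"
proof (cases "\<forall>x. f x = 0")
  case True
  then show thesis using that[of 0] by simp
next
  case False
  interpret f: bounded_linear f by fact
  let ?M = "{x. f x = 0}"
  have "csubspace ?M"
    by (auto simp: csubspace_def f.zero f.add fC)
  moreover have "closed ?M"
    by (intro closed_Collect_eq f.continuous_on continuous_intros)
  ultimately have "\<exists>p. f p = 0 \<and> (\<forall>z. f z = 0 \<longrightarrow> cinner (x - p) z = 0)" for x
    by (rule orthogonal_projection_exists[of ?M x]) auto
  moreover obtain x0 where x0: "f x0 \<noteq> 0" using False by blast
  ultimately obtain p where p: "f p = 0" "\<And>z. f z = 0 \<Longrightarrow> cinner (x0 - p) z = 0"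
    by blast
  let ?w = "x0 - p"
  have fw: "f ?w \<noteq> 0" using x0 p by (simp add: f.diff)
  then have w: "?w \<noteq> 0" by (metis f.zero)
  show thesis
  proof (rule that)
    fix x
    let ?c = "f x / f ?w"
    have "f (x - ?c *\<^sub>C ?w) = 0"
      using fw by (simp only: f.diff[of x] fC) simp
    then have "cinner (x - ?c *\<^sub>C ?w) ?w = 0"
      using p(2) by (metis cinner_commute complex_cnj_zero)
    then have "cinner x ?w = ?c * of_real ((norm ?w)\<^sup>2)"
      by (simp only: cinner_diff_left[of x] cinner_scaleC_left cinner_self) simp
    then show "f x = cinner x ((cnj (f ?w) / of_real ((norm ?w)\<^sup>2)) *\<^sub>C ?w)"
      using fw w by (simp add: cinner_scaleC_right)
  qed
qed

section \<open>Bounded complex-linear operators and their adjoints\<close>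

lemma bounded_clinear_bounded_linear: "bounded_clinear T \<Longrightarrow> bounded_linear T"
  and bounded_clinear_scaleC: "bounded_clinear T \<Longrightarrow> T (c *\<^sub>C x) = c *\<^sub>C T x"
  by (simp_all add: bounded_clinear_def)

lemma bounded_clinear_intro:
  fixes T :: "'a::complex_inner \<Rightarrow> 'a"
  assumes "\<And>x y. T (x + y) = T x + T y" "\<And>c x. T (c *\<^sub>C x) = c *\<^sub>C T x"
    and "\<And>x. norm (T x) \<le> norm x * K"
  shows "bounded_clinear T"
  unfolding bounded_clinear_def
  using assms by (auto intro!: bounded_linear_intro[where K = K] simp flip: scaleC_of_real)

lemma bounded_clinear_comp:
  "bounded_clinear S \<Longrightarrow> bounded_clinear T \<Longrightarrow> bounded_clinear (S \<circ> T)"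
  unfolding bounded_clinear_def by (auto simp: comp_def intro: bounded_linear_compose)

lemma csubspace_range: "bounded_clinear T \<Longrightarrow> csubspace (range T)"
  unfolding csubspace_def
  by (auto simp flip: bounded_clinear_scaleC linear_simps(1)[OF bounded_clinear_bounded_linear])
    (metis bounded_clinear_bounded_linear linear_simps(3) rangeI)

lemma csubspace_kernel: "bounded_clinear T \<Longrightarrow> csubspace {x. T x = 0}"
  unfolding csubspace_def
  using bounded_clinear_scaleC[of T _ 0]
  by (auto simp: bounded_clinear_scaleC linear_simps[OF bounded_clinear_bounded_linear])
    (metis bounded_clinear_bounded_linear bounded_clinear_scaleC linear_simps(3) norm_eq_zero
      norm_scaleC mult_zero_right)

lemma cinner_eqI:
  fixes u v :: "'a::complex_inner"
  assumes "\<And>x. cinner x u = cinner x v"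
  shows "u = v"
proof -
  have "cinner (u - v) (u - v) = 0"
    using assms[of "u - v"] by (simp add: cinner_diff_right)
  then show ?thesis by (simp add: cinner_eq_zero_iff)
qed

text \<open>For each \<open>y\<close>, Riesz represents the functional \<open>cinner (T x) y\<close>
  of \<open>x\<close>; choosing the representing vectors gives a map that uniqueness identifies with
  the described \<open>cadjoint T\<close>.\<close>

lemma cinner_cadjoint:
  fixes T :: "'a::chilbert_space \<Rightarrow> 'a"
  assumes T: "bounded_clinear T"
  shows "cinner (T x) y = cinner x (cadjoint T y)"
proof -
  interpret T: bounded_linear T
    using T by (rule bounded_clinear_bounded_linear)
  have "\<exists>s. \<forall>x. cinner (T x) y = cinner x s" for y
  proof -
    obtain K where K: "\<And>x. norm (T x) \<le> norm x * K"
      using T.bounded by blast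
    have "bounded_linear (\<lambda>x. cinner (T x) y)"
    proof (rule bounded_linear_intro)
      show "norm (cinner (T x) y) \<le> norm x * (K * norm y)" for x
        using cinner_Cauchy_Schwarz[of "T x" y] mult_right_mono[OF K[of x] norm_ge_zero[of y]]
        by (simp add: mult.assoc)
    qed (simp_all add: T.add T.scaleR cinner_add_left cinner_scaleR_left scaleR_conv_of_real)
    then show ?thesis
      using Riesz_representation[of "\<lambda>x. cinner (T x) y"]
      by (metis T bounded_clinear_scaleC cinner_scaleC_left)
  qed
  then obtain S where "\<And>x y. cinner (T x) y = cinner x (S y)" by metis
  then show ?thesis
    using cadjoint_unique by metis
qed

lemma bounded_clinear_cadjoint:
  fixes T :: "'a::chilbert_space \<Rightarrow> 'a"
  assumes T: "bounded_clinear T"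
  shows "bounded_clinear (cadjoint T)"
proof -
  interpret T: bounded_linear T
    using T by (rule bounded_clinear_bounded_linear)
  obtain K where K: "\<And>x. norm (T x) \<le> norm x * K"
    using T.bounded by blast
  show ?thesis
  proof (rule bounded_clinear_intro)
    show "cadjoint T (x + y) = cadjoint T x + cadjoint T y" for x y
      by (rule cinner_eqI) (simp add: cinner_add_right flip: cinner_cadjoint[OF T])
    show "cadjoint T (c *\<^sub>C x) = c *\<^sub>C cadjoint T x" for c x
      by (rule cinner_eqI) (simp add: cinner_scaleC_right flip: cinner_cadjoint[OF T])
    show "norm (cadjoint T x) \<le> norm x * K" for x
    proof -
      let ?s = "cadjoint T x"
      have "norm ?s * norm ?s = cmod (cinner (T ?s) x)"
        by (simp add: cinner_cadjoint[OF T] cinner_self norm_mult power2_eq_square)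
      also have "\<dots> \<le> norm (T ?s) * norm x"
        by (rule cinner_Cauchy_Schwarz)
      also have "\<dots> \<le> norm ?s * (norm x * K)"
        using mult_right_mono[OF K[of ?s] norm_ge_zero[of x]] by (simp add: mult_ac)
      finally have "norm ?s * norm ?s \<le> norm ?s * (norm x * K)" .
      \<comment> \<open>If \<open>?s = 0\<close>, the common factor cannot be cancelled, and this
        inequality is the claim itself.\<close>
      moreover have "0 \<le> norm x * K"
        using norm_ge_zero K by (rule order_trans)
      ultimately show ?thesis
        by (cases "?s = 0") auto
    qed
  qed
qed

lemma cadjoint_comp:
  fixes S T :: "'a::chilbert_space \<Rightarrow> 'a"
  assumes "bounded_clinear S" "bounded_clinear T"
  shows "cadjoint (S \<circ> T) = cadjoint T \<circ> cadjoint S"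
  by (rule cadjoint_unique) (simp add: cinner_cadjoint assms)

subsection \<open>The pseudo-inverse and the minus order\<close>

text \<open>A mere choice of norm-controlled preimages need not be linear. Orthogonality to the
  range and to the kernel singles out one value, and thereby makes \<open>G\<close> linear.\<close>

lemma pseudo_inverse_exists:
  fixes T :: "'a::chilbert_space \<Rightarrow> 'a"
  assumes T: "bounded_clinear T" and cl: "closed (range T)"
  obtains G where "bounded_clinear G" "\<And>y. y \<in> range T \<Longrightarrow> T (G y) = y"
proof -
  interpret T: bounded_linear T
    using T by (rule bounded_clinear_bounded_linear)
  obtain K where K: "\<And>v. v \<in> range T \<Longrightarrow> \<exists>a. T a = v \<and> norm a \<le> K * norm v"
    by (rule closed_range_bounded_preimage[OF T.bounded_linear_axioms cl]) (rule that)
  \<comment> \<open>\<open>R y x\<close> says that \<open>x\<close> is the minimal-norm least-squares solution of \<open>T x = y\<close>; as a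
    relation it is linear, so linearity of the Moore--Penrose inverse follows from uniqueness of \<open>x\<close>.\<close>
  define R where "R y x \<longleftrightarrow>
    (\<forall>z. cinner (y - T x) (T z) = 0) \<and> (\<forall>z. T z = 0 \<longrightarrow> cinner x z = 0)" for y x
  have ker: "closed {x. T x = 0}"
    by (intro closed_Collect_eq T.continuous_on continuous_intros)
  \<comment> \<open>Project \<open>y\<close> onto the closed range, take any preimage of the
    projection, and remove its kernel component, which leaves its image unchanged.\<close>
  have R_ex: "\<exists>x. R y x" for y
  proof -
    obtain p where "p \<in> range T" and p: "\<And>w. w \<in> range T \<Longrightarrow> cinner (y - p) w = 0"
      by (rule orthogonal_projection_exists[OF csubspace_range[OF T] cl, of y]) (rule that)
    then obtain x where x: "\<And>z. cinner (y - T x) (T z) = 0"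
      by auto
    obtain n where "n \<in> {z. T z = 0}" "\<And>z. z \<in> {z. T z = 0} \<Longrightarrow> cinner (x - n) z = 0"
      by (rule orthogonal_projection_exists[OF csubspace_kernel[OF T] ker, of x]) (rule that)
    then have n: "T n = 0" "\<And>z. T z = 0 \<Longrightarrow> cinner (x - n) z = 0"
      by auto
    have "R y (x - n)"
      using x n by (simp add: R_def T.diff)
    then show ?thesis ..
  qed
  have R_add: "R (y + y') (x + x')" if "R y x" "R y' x'" for x x' y y'
    using that unfolding R_def
    by (simp add: T.add cinner_add_left cinner_diff_left)
  have R_scaleC: "R (c *\<^sub>C y) (c *\<^sub>C x)" if "R y x" for c x y
    using that unfolding R_def
    by (simp add: bounded_clinear_scaleC[OF T] cinner_scaleC_left cinner_diff_left)
  \<comment> \<open>Pythagoras is used twice: \<open>x\<close> is orthogonal to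
    \<open>a - x\<close>, which lies in the kernel, so \<open>x\<close> is no longer than
    \<open>a\<close>; and \<open>T x\<close> is no longer than \<open>y\<close>. The absolute value
    covers a \<open>K\<close> of unknown sign.\<close>
  have R_norm: "norm x \<le> norm y * \<bar>K\<bar>" if R: "R y x" for x y
  proof -
    obtain a where a: "T a = T x" "norm a \<le> K * norm (T x)"
      using K[of "T x"] by auto
    have "cinner x (a - x) = 0"
      using R a by (simp add: R_def T.diff)
    then have "(norm a)\<^sup>2 = (norm x)\<^sup>2 + (norm (a - x))\<^sup>2"
      using norm_add_sq[of x "a - x"] by simp
    then have "(norm x)\<^sup>2 \<le> (norm a)\<^sup>2" by simp
    then have "norm x \<le> norm a"
      by (rule power2_le_imp_le) simp
    moreover have "cinner (y - T x) (T x) = 0"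
      using R by (simp add: R_def)
    then have "(norm y)\<^sup>2 = (norm (y - T x))\<^sup>2 + (norm (T x))\<^sup>2"
      using norm_add_sq[of "y - T x" "T x"] by simp
    then have "(norm (T x))\<^sup>2 \<le> (norm y)\<^sup>2" by simp
    then have "norm (T x) \<le> norm y"
      by (rule power2_le_imp_le) simp
    then have "K * norm (T x) \<le> \<bar>K\<bar> * norm y"
      by (intro mult_mono) auto
    ultimately show ?thesis
      using a(2) by (simp add: mult.commute)
  qed
  \<comment> \<open>The difference of two solutions solves the problem for 0, where the norm bound
    forces it to vanish.\<close>
  have R_unique: "x = x'" if "R y x" "R y x'" for x x' y
  proof -
    have "R (y + (-1) *\<^sub>C y) (x + (-1) *\<^sub>C x')"
      using that by (intro R_add R_scaleC)
    moreover have "(-1) *\<^sub>C z = - z" for z :: 'a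
      using scaleC_of_real[of "- 1" z] by simp
    ultimately have "R 0 (x - x')" by simp
    from R_norm[OF this] show ?thesis by simp
  qed
  obtain G where G: "\<And>y. R y (G y)"
    using R_ex by metis
  show thesis
  proof (rule that)
    show "bounded_clinear G"
    proof (rule bounded_clinear_intro)
      show "G (x + y) = G x + G y" for x y
        using R_unique G R_add by blast
      show "G (c *\<^sub>C x) = c *\<^sub>C G x" for c x
        using R_unique G R_scaleC by blast
    qed (rule R_norm[OF G])
    fix y assume "y \<in> range T"
    then obtain w where w: "y = T w" by blast
    \<comment> \<open>The test vector \<open>w - G y\<close> is chosen so that its image is the
      residual \<open>y - T (G y)\<close> itself.\<close>
    have "cinner (y - T (G y)) (T (w - G y)) = 0"
      using G[of y] unfolding R_def by blast
    then show "T (G y) = y"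
      by (simp add: w T.diff cinner_eq_zero_iff)
  qed
qed

text \<open>The difference \<open>a - a'\<close> equals \<open>b' - b\<close>, so it lies in both
  summands and is zero.\<close>

lemma direct_sum_unique:
  assumes "is_direct_sum S M N" "subspace M" "subspace N"
    and "a \<in> M" "a' \<in> M" "b \<in> N" "b' \<in> N" "a + b = a' + b'"
  shows "a = a'"
proof -
  have "a - a' = b' - b"
    using assms(8) by (metis add_diff_cancel_left' add_diff_cancel_right' add_diff_eq diff_diff_eq2 diff_add_eq)
  then have "a - a' \<in> M \<inter> N"
    using assms subspace_diff by (metis IntI)
  then have "a - a' = 0"
    using assms(1) unfolding is_direct_sum_def by blast
  then show ?thesis by simp
qed

theorem corollary3p16:
  fixes A B :: "'a::chilbert_space \<Rightarrow> 'a"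
  assumes "bounded_clinear A" and "bounded_clinear B"
    and "is_direct_sum (range B) (range A) (range (\<lambda>x. B x - A x))"
    and "closed (range B)"
  shows "closed (range A) \<and> closed (range (\<lambda>x. B x - A x)) \<and>
    (\<exists>P Q. bounded_clinear P \<and> bounded_clinear Q \<and> P \<circ> P = P \<and> Q \<circ> Q = Q \<and>
      A = P \<circ> B \<and> cadjoint A = Q \<circ> cadjoint B)"
proof -
  interpret A: bounded_linear A
    using assms(1) by (rule bounded_clinear_bounded_linear)
  interpret B: bounded_linear B
    using assms(2) by (rule bounded_clinear_bounded_linear)
  let ?C = "\<lambda>x. B x - A x"
  have C: "bounded_linear ?C"
    by (intro bounded_linear_sub A.bounded_linear_axioms B.bounded_linear_axioms)
  have sub: "subspace (range A)" "subspace (range ?C)"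
    by (auto intro!: linear_subspace_image bounded_linear.linear A.bounded_linear_axioms C)
  have C_range: "B z - A z \<in> range ?C" for z
    by blast
  have A_eq: "A z = a" if "B z = a + c" "a \<in> range A" "c \<in> range ?C" for z a c
    by (rule direct_sum_unique[OF assms(3) sub rangeI that(2) C_range[of z] that(3)])
      (simp add: that(1))
  have A_if_B: "A x = A y" if "B x = B y" for x y
    using A_eq[of x "A y" "?C y"] that by simp
  have C0: "0 \<in> range ?C"
    using sub(2) subspace_0 by blast
  have A_sub: "A x \<in> range B" for x
  proof -
    have "A x + 0 \<in> {a + c |a c. a \<in> range A \<and> c \<in> range ?C}"
      using C0 by blast
    then show ?thesis
      using assms(3) unfolding is_direct_sum_def by simp
  qed
  obtain G where G: "bounded_clinear G" "\<And>y. y \<in> range B \<Longrightarrow> B (G y) = y"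
    using pseudo_inverse_exists[OF assms(2,4)] by blast
  have BGA: "B (G (A x)) = A x" for x
    using G(2) A_sub by blast
  \<comment> \<open>By \<open>BGA\<close>, the vector \<open>B (G (A x))\<close> has the
    decomposition \<open>A x + 0\<close>.\<close>
  have AGA: "A (G (A x)) = A x" for x
    using A_eq[of "G (A x)" "A x" 0] BGA C0 by simp
  have AGB: "A (G (B x)) = A x" for x
    using A_if_B G(2) by blast
  define P where "P = A \<circ> G"
  define E where "E = G \<circ> A"
  have P: "bounded_clinear P" and E: "bounded_clinear E"
    unfolding P_def E_def using assms(1) G(1) by (auto intro: bounded_clinear_comp)
  have contP: "continuous_on UNIV P"
    using P bounded_clinear_bounded_linear linear_continuous_on by blast
  have "range A = {y. P y = y}"
    by (auto simp: P_def AGA intro: sym)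
  moreover have "closed {y. P y = y}"
    by (intro closed_Collect_eq contP continuous_on_id)
  moreover have "range ?C = range B \<inter> {y. P y = 0}"
  proof (intro equalityI subsetI)
    fix y assume "y \<in> range ?C"
    then obtain x where x: "y = B x - A x" by blast
    have "P y = P (B x) - P (A x)"
      unfolding x using P by (intro linear_simps(2) bounded_clinear_bounded_linear)
    then have "P y = 0"
      by (simp add: P_def AGA AGB)
    \<comment> \<open>Writing \<open>A x\<close> as \<open>B (G (A x))\<close> puts the difference
      into the range of \<open>B\<close>.\<close>
    moreover have "y = B (x - G (A x))"
      by (simp add: x B.diff BGA)
    ultimately show "y \<in> range B \<inter> {y. P y = 0}" by blast
  next
    fix y assume "y \<in> range B \<inter> {y. P y = 0}"
    \<comment> \<open>For \<open>y = B z\<close>, the value \<open>P y\<close> is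
      \<open>A (G (B z))\<close>, which is \<open>A z\<close>.\<close>
    then obtain z where "y = B z" "A z = 0"
      by (auto simp: P_def AGB)
    then have "y = ?C z" by simp
    then show "y \<in> range ?C" by blast
  qed
  moreover have "closed (range B \<inter> {y. P y = 0})"
    by (intro closed_Int assms(4) closed_Collect_eq contP continuous_on_const)
  moreover have "P \<circ> P = P" "A = P \<circ> B"
    by (auto simp: P_def AGA AGB)
  \<comment> \<open>Adjoints reverse composition, so this right factor \<open>E\<close> of
    \<open>A\<close> becomes the left factor needed for \<open>cadjoint A\<close>.\<close>
  moreover have "E \<circ> E = E" "A = B \<circ> E"
    by (auto simp: E_def AGA BGA)
  then have "cadjoint E \<circ> cadjoint E = cadjoint E" "cadjoint A = cadjoint E \<circ> cadjoint B"
    using cadjoint_comp E assms(2) by metis+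
  moreover have "bounded_clinear (cadjoint E)"
    using E by (rule bounded_clinear_cadjoint)
  ultimately show ?thesis
    using P by auto
qed

end
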